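(* Let $\Sigma \supseteq \{\to\}$ be a signature and let $P_0$ be a $\Sigma$-calculus with $P_0 \geq \mathbf{Int}_{\{\to\}}$. Then the following two problems are undecidable: (i) (Recognizing axiomatizations for $P_0$) given a $\Sigma$-calculus $P$, determine whether $P_0 \sim P$; (ii) (Recognizing completeness for $P_0$) given a $\Sigma$-calculus $P$ such that $P \leq P_0$, determine whether $P_0 \leq P$.
   Context: Fix an infinite set $\mathcal V$ of propositional variables. A signature $\Sigma$ is a finite set of connectives, each with an arity and associated with a classical two-valued truth function; here $\Sigma$ contains the binary connective $\to$ (implication). $\Sigma$-formulas are built from $\mathcal V$ and the connectives of $\Sigma$ in the usual way. A $\Sigma$-calculus is given by a finite set $P$ of $\Sigma$-formulas (the axioms) together with two rules of inference: modus ponens (from $A$ and $A\to B$ infer $B$) and substitution (from $A$ infer $\sigma A$, where $\sigma$ is any substitution of $\Sigma$-formulas for variables). $[P]$ denotes the set of formulas derivable from $P$ by these rules. Write $P_1 \leq P_2$ (equivalently $P_2\geq P_1$) if $[P_1]\subseteq [P_2]$, and $P_1\sim P_2$ if $[P_1]=[P_2]$. $\mathbf{Int}_{\{\to\}}$ is the $\{\to\}$-calculus (intuitionistic implicational propositional calculus) with the two axioms $x\to(y\to x)$ and $(x\to(y\to z))\to((x\to y)\to(x\to z))$. A problem is undecidable if there is no algorithm that halts with the correct answer on every admissible input; the inputs are finite sets of $\Sigma$-formulas $P$, and in problem (ii) the admissible inputs are those with $P\leq P_0$ (the algorithm need not behave in any particular way on other inputs). *)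

theory Defs
  imports Main "HOL-Library.Nat_Bijection" "HOL-Library.Countable_Set"
begin

text \<open>
  The truth function of a connective \<open>c\<close> is only meaningful on argument lists of length
  \<open>arity \<Sigma> c\<close>.  The field \<open>impl\<close> names the connective that plays the role of implication.
\<close>

record 'c signature =
  conns :: "'c set"
  arity :: "'c \<Rightarrow> nat"
  truth :: "'c \<Rightarrow> bool list \<Rightarrow> bool"
  impl  :: 'c

definition signature_with_impl :: "'c signature \<Rightarrow> bool" where
  "signature_with_impl \<Sigma> \<longleftrightarrow>
     finite (conns \<Sigma>) \<and> impl \<Sigma> \<in> conns \<Sigma> \<and> arity \<Sigma> (impl \<Sigma>) = 2 \<and>
     (\<forall>a b. truth \<Sigma> (impl \<Sigma>) [a, b] = (a \<longrightarrow> b))"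

definition impl_reduct :: "'c signature \<Rightarrow> 'c signature" where
  "impl_reduct \<Sigma> = \<Sigma>\<lparr>conns := {impl \<Sigma>}\<rparr>"

datatype 'c formula = Var nat | App 'c "'c formula list"

inductive_set formulas :: "'c signature \<Rightarrow> 'c formula set" for \<Sigma> :: "'c signature" where
  Var: "Var v \<in> formulas \<Sigma>"
| App: "\<lbrakk>c \<in> conns \<Sigma>; length As = arity \<Sigma> c; \<forall>A\<in>set As. A \<in> formulas \<Sigma>\<rbrakk>
        \<Longrightarrow> App c As \<in> formulas \<Sigma>"

abbreviation Imp :: "'c signature \<Rightarrow> 'c formula \<Rightarrow> 'c formula \<Rightarrow> 'c formula" where
  "Imp \<Sigma> A B \<equiv> App (impl \<Sigma>) [A, B]"

primrec subst :: "(nat \<Rightarrow> 'c formula) \<Rightarrow> 'c formula \<Rightarrow> 'c formula" where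
  "subst \<sigma> (Var v) = \<sigma> v"
| "subst \<sigma> (App c As) = App c (map (subst \<sigma>) As)"

text \<open>
  A calculus is a signature together with its axioms; the signature determines which
  formulas may be substituted.
\<close>

type_synonym 'c calculus = "'c signature \<times> 'c formula set"

definition calculus :: "'c calculus \<Rightarrow> bool" where
  "calculus C \<longleftrightarrow> finite (snd C) \<and> snd C \<subseteq> formulas (fst C)"

inductive_set theorems :: "'c calculus \<Rightarrow> 'c formula set" for C :: "'c calculus" where
  Axiom: "A \<in> snd C \<Longrightarrow> A \<in> theorems C"
| MP: "\<lbrakk>A \<in> theorems C; Imp (fst C) A B \<in> theorems C\<rbrakk> \<Longrightarrow> B \<in> theorems C"
| Subst: "\<lbrakk>A \<in> theorems C; \<forall>v. \<sigma> v \<in> formulas (fst C)\<rbrakk> \<Longrightarrow> subst \<sigma> A \<in> theorems C"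

definition calc_le :: "'c calculus \<Rightarrow> 'c calculus \<Rightarrow> bool" (infix "\<preceq>" 50) where
  "C \<preceq> D \<longleftrightarrow> theorems C \<subseteq> theorems D"

definition calc_equiv :: "'c calculus \<Rightarrow> 'c calculus \<Rightarrow> bool" (infix "\<approx>" 50) where
  "C \<approx> D \<longleftrightarrow> theorems C = theorems D"

definition Int_impl :: "'c signature \<Rightarrow> 'c calculus" where
  "Int_impl \<Sigma> =
    (let imp = Imp \<Sigma>; x = Var 0; y = Var 1; z = Var 2
     in (impl_reduct \<Sigma>,
         {imp x (imp y x),
          imp (imp x (imp y z)) (imp (imp x y) (imp x z))}))"

text \<open>
  Algorithms are partial recursive functions, given by their defining schemes with a
  big-step semantics: \<open>evaluates f xs y\<close> says that \<open>f\<close> halts on \<open>xs\<close> with value \<open>y\<close>.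
\<close>

datatype recf =
  Zero | Succ | Proj nat | Comp recf "recf list" | PrimRec recf recf | Mu recf

inductive evaluates :: "recf \<Rightarrow> nat list \<Rightarrow> nat \<Rightarrow> bool" where
  Zero: "evaluates Zero xs 0"
| Succ: "evaluates Succ [x] (Suc x)"
| Proj: "i < length xs \<Longrightarrow> evaluates (Proj i) xs (xs ! i)"
| Comp: "\<lbrakk>list_all2 (\<lambda>g y. evaluates g xs y) gs ys; evaluates f ys z\<rbrakk>
         \<Longrightarrow> evaluates (Comp f gs) xs z"
| PrimRec_0: "evaluates f xs z \<Longrightarrow> evaluates (PrimRec f g) (0 # xs) z"
| PrimRec_Suc: "\<lbrakk>evaluates (PrimRec f g) (n # xs) y; evaluates g (n # y # xs) z\<rbrakk>
                \<Longrightarrow> evaluates (PrimRec f g) (Suc n # xs) z"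
| Mu: "\<lbrakk>evaluates f (n # xs) 0; \<forall>m<n. \<exists>y. evaluates f (m # xs) (Suc y)\<rbrakk>
       \<Longrightarrow> evaluates (Mu f) xs n"

lemma evaluates_deterministic:
  "evaluates f xs y \<Longrightarrow> evaluates f xs y' \<Longrightarrow> y = y'"
proof (induction arbitrary: y' rule: evaluates.induct)
  case (Comp xs gs ys f z)
  from Comp.prems obtain ys' where
    *: "list_all2 (\<lambda>g y. evaluates g xs y) gs ys'" "evaluates f ys' y'"
    by (cases rule: evaluates.cases) auto
  have "ys = ys'"
    using Comp.IH(1) *(1) by (auto simp: list_all2_conv_all_nth intro!: nth_equalityI)
  with Comp.IH(2) *(2) show ?case by blast
next
  case (PrimRec_Suc f g n xs y z)
  from PrimRec_Suc.prems show ?case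
    by (cases rule: evaluates.cases) (use PrimRec_Suc.IH in auto)
next
  case (Mu f n xs)
  from Mu.prems have *: "evaluates f (y' # xs) 0" "\<forall>m<y'. \<exists>y. evaluates f (m # xs) (Suc y)"
    by (cases rule: evaluates.cases; auto)+
  show ?case
  proof (rule linorder_cases[of n y'])
    assume "n < y'" then show ?thesis using Mu.IH(1) *(2) by blast
  next
    assume "y' < n" then show ?thesis using Mu.IH(2) *(1) by blast
  qed
qed (erule evaluates.cases; auto)+

text \<open>
  Since \<open>conns \<Sigma>\<close> is finite, \<open>to_nat_on (conns \<Sigma>)\<close> numbers the connectives from \<open>0\<close> to
  \<open>card (conns \<Sigma>) - 1\<close>; which numbering it is does not affect decidability.
\<close>

primrec formula_code :: "'c signature \<Rightarrow> 'c formula \<Rightarrow> nat" where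
  "formula_code \<Sigma> (Var v) = prod_encode (0, v)"
| "formula_code \<Sigma> (App c As) =
     prod_encode (Suc (to_nat_on (conns \<Sigma>) c), list_encode (map (formula_code \<Sigma>) As))"

lemma formula_code_inj:
  assumes "finite (conns \<Sigma>)"
  shows "inj_on (formula_code \<Sigma>) (formulas \<Sigma>)"
proof -
  have "A = B" if "A \<in> formulas \<Sigma>" "B \<in> formulas \<Sigma>" "formula_code \<Sigma> A = formula_code \<Sigma> B"
    for A B
    using that
  proof (induction arbitrary: B rule: formulas.induct)
    case (Var v)
    then show ?case by (cases B) (auto simp: prod_encode_eq)
  next
    case (App c As)
    from App.prems obtain d Bs where B: "B = App d Bs" "d \<in> conns \<Sigma>" "\<forall>B\<in>set Bs. B \<in> formulas \<Sigma>"
      by (cases rule: formulas.cases) (auto simp: prod_encode_eq)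
    have "to_nat_on (conns \<Sigma>) c = to_nat_on (conns \<Sigma>) d"
      and m: "map (formula_code \<Sigma>) As = map (formula_code \<Sigma>) Bs"
      using App.prems(2) B by (auto simp: prod_encode_eq list_encode_eq)
    then have "c = d"
      using App.hyps(1) B(2) assms by (simp add: countable_finite)
    moreover have "As = Bs"
      using m App.IH B(3)
      by (metis (no_types, lifting) list.inj_map_strong)
    ultimately show ?case using B(1) by simp
  qed
  then show ?thesis by (auto intro: inj_onI)
qed

text \<open>
  A finite axiom set is presented to an algorithm as a list of its elements, in any order and
  possibly with repetitions.  The algorithm has to halt with the correct answer (\<open>1\<close> for yes,
  \<open>0\<close> for no) on the inputs that satisfy \<open>adm\<close>; its behaviour elsewhere is unconstrained.
\<close>

definition decidable_for_calculi ::
    "'c signature \<Rightarrow> ('c calculus \<Rightarrow> bool) \<Rightarrow> ('c calculus \<Rightarrow> bool) \<Rightarrow> bool" where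
  "decidable_for_calculi \<Sigma> adm Q \<longleftrightarrow>
     (\<exists>f. \<forall>As. set As \<subseteq> formulas \<Sigma> \<longrightarrow> adm (\<Sigma>, set As) \<longrightarrow>
        evaluates f [list_encode (map (formula_code \<Sigma>) As)] (if Q (\<Sigma>, set As) then 1 else 0))"

end

theory Submission
  imports Defs
begin

text \<open>
  Modus ponens and substitution execute Horn clauses.  Write \<open>claim t\<close> for \<open>t \<rightarrow> t\<close>; then the
  axiom \<open>claim t\<^sub>1 \<rightarrow> \<dots> \<rightarrow> claim t\<^sub>k \<rightarrow> claim t\<close> lets one pass from instances of the premises to the
  corresponding instance of the conclusion, and since every \<open>t \<rightarrow> t\<close> is a theorem of
  intuitionistic implicational logic, so is every such clause.  It is therefore possible to write
  a logic program below \<open>P\<^sub>0\<close> whose facts say "the recursive function \<open>f\<close> has value \<open>y\<close> on \<open>xs\<close>"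
  and which derives \<open>claim halt\<close> once a given function halts on a given input.  Adding the
  clauses \<open>claim halt \<rightarrow> A\<close> for the axioms \<open>A\<close> of \<open>P\<^sub>0\<close>, which still are theorems of \<open>P\<^sub>0\<close> by
  weakening, gives a calculus below \<open>P\<^sub>0\<close> that is complete for \<open>P\<^sub>0\<close> if the computation halts
  (\<open>evaluates_derivable\<close>, \<open>halt_derivable\<close>).

  The converse needs that a clause cannot be misused by taking an arbitrary theorem for one of its
  premises.  Atoms are built with \<open>pair a b = (a \<rightarrow> b) \<rightarrow> b\<close>, which is never of the shape \<open>A \<rightarrow> A\<close>.
  So a clause with a premise \<open>claim s\<close> never has the form \<open>claim t\<close> for an instance \<open>t\<close> of an
  atom, because then \<open>t\<close> would be \<open>s \<rightarrow> s\<close>; and a theorem can discharge a premise only by being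
  a claim that was derived as such.  The set
  \<open>sound\<close> makes this precise: it is closed under modus ponens (\<open>sound_MP\<close>), it contains all
  instances of the axioms if the computation does not halt (\<open>program_sound\<close>,
  \<open>halting_clause_sound\<close>), and it misses \<open>x \<rightarrow> (y \<rightarrow> x)\<close> (\<open>K_not_sound\<close>), a theorem of \<open>P\<^sub>0\<close>.

  Undecidability follows by diagonalization rather than from a known undecidable problem.  The
  input \<open>n\<close> enters the calculus through one axiom \<open>input n\<close>, whose code is a recursive function
  of \<open>n\<close>.  From a supposed decision procedure one builds a function that, on input \<open>e\<close>, asks
  the procedure about the axiom list consisting of \<open>input e\<close> and the list coded by \<open>e\<close>, and halts
  iff the answer is no; the contradiction arises when \<open>e\<close> codes the remaining axioms of the
  calculus that belongs to this very function.  Recognizing axiomatizations is at least as hard,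
  because on calculi below \<open>P\<^sub>0\<close> the two questions have the same answer.
\<close>


section \<open>Recursive functions\<close>

definition recursive1 :: "(nat \<Rightarrow> nat) \<Rightarrow> bool" where
  "recursive1 F \<longleftrightarrow> (\<exists>r. \<forall>x. evaluates r [x] (F x))"

definition recursive2 :: "(nat \<Rightarrow> nat \<Rightarrow> nat) \<Rightarrow> bool" where
  "recursive2 F \<longleftrightarrow> (\<exists>r. \<forall>x y. evaluates r [x, y] (F x y))"

lemma evaluates_Comp1:
  "evaluates g xs y \<Longrightarrow> evaluates f [y] z \<Longrightarrow> evaluates (Comp f [g]) xs z"
  by (rule evaluates.Comp[where ys = "[y]"]) auto

lemma evaluates_Comp2:
  "evaluates g xs y \<Longrightarrow> evaluates h xs y' \<Longrightarrow> evaluates f [y, y'] z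
    \<Longrightarrow> evaluates (Comp f [g, h]) xs z"
  by (rule evaluates.Comp[where ys = "[y, y']"]) auto

lemma evaluates_const: "\<exists>r. \<forall>xs. evaluates r xs k"
proof (induction k)
  case 0
  show ?case by (blast intro: evaluates.Zero)
next
  case (Suc k)
  then show ?case by (meson evaluates_Comp1 evaluates.Succ)
qed

lemma recursive1_const: "recursive1 (\<lambda>_. k)"
  unfolding recursive1_def using evaluates_const by blast

lemma recursive1_id: "recursive1 (\<lambda>x. x)"
  unfolding recursive1_def using evaluates.Proj[of 0 "[x]" for x] by auto

lemma recursive2_const: "recursive2 (\<lambda>_ _. k)"
  unfolding recursive2_def using evaluates_const by blast

lemma recursive2_fst: "recursive2 (\<lambda>x _. x)"
  unfolding recursive2_def using evaluates.Proj[of 0 "[x, y]" for x y] by auto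

lemma recursive2_snd: "recursive2 (\<lambda>_ y. y)"
  unfolding recursive2_def using evaluates.Proj[of 1 "[x, y]" for x y] by auto

lemma recursive1_comp2:
  "recursive2 F \<Longrightarrow> recursive1 G \<Longrightarrow> recursive1 H \<Longrightarrow> recursive1 (\<lambda>x. F (G x) (H x))"
  unfolding recursive1_def recursive2_def by (meson evaluates_Comp2)

lemma recursive2_comp2:
  "recursive2 F \<Longrightarrow> recursive2 G \<Longrightarrow> recursive2 H \<Longrightarrow> recursive2 (\<lambda>x y. F (G x y) (H x y))"
  unfolding recursive2_def by (meson evaluates_Comp2)

lemma recursive1_Suc: "recursive1 F \<Longrightarrow> recursive1 (\<lambda>x. Suc (F x))"
  unfolding recursive1_def by (meson evaluates_Comp1 evaluates.Succ)

lemma recursive2_Suc: "recursive2 F \<Longrightarrow> recursive2 (\<lambda>x y. Suc (F x y))"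
  unfolding recursive2_def by (meson evaluates_Comp1 evaluates.Succ)

lemma recursive2_comp1: "recursive1 F \<Longrightarrow> recursive2 G \<Longrightarrow> recursive2 (\<lambda>x y. F (G x y))"
  unfolding recursive1_def recursive2_def by (meson evaluates_Comp1)

lemma recursive1_primrec:
  assumes "recursive2 H" and F0: "F 0 = k" and FSuc: "\<And>n. F (Suc n) = H n (F n)"
  shows "recursive1 F"
proof -
  obtain h where h: "\<And>x y. evaluates h [x, y] (H x y)"
    using assms(1) unfolding recursive2_def by blast
  obtain c where c: "\<And>xs. evaluates c xs k"
    using evaluates_const by blast
  have "evaluates (PrimRec c h) [n] (F n)" for n
  proof (induction n)
    case 0
    show ?case by (simp add: F0 c evaluates.PrimRec_0)
  next
    case (Suc n)
    then show ?case by (metis FSuc h evaluates.PrimRec_Suc)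
  qed
  then show ?thesis unfolding recursive1_def by blast
qed

lemma recursive2_add: "recursive2 (\<lambda>x y. x + y)"
proof -
  have "evaluates (PrimRec (Proj 0) (Comp Succ [Proj 1])) [x, y] (x + y)" for x y
  proof (induction x)
    case 0
    show ?case using evaluates.Proj[of 0 "[y]"] by (auto intro: evaluates.PrimRec_0)
  next
    case (Suc x)
    have "evaluates (Proj 1) [x, x + y, y] (x + y)"
      using evaluates.Proj[of 1 "[x, x + y, y]"] by simp
    then have "evaluates (Comp Succ [Proj 1]) [x, x + y, y] (Suc (x + y))"
      by (rule evaluates_Comp1) (rule evaluates.Succ)
    with Suc show ?case by (auto intro: evaluates.PrimRec_Suc)
  qed
  then show ?thesis unfolding recursive2_def by blast
qed

lemma recursive2_prod_encode: "recursive2 (\<lambda>x y. prod_encode (x, y))"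
proof -
  have "recursive1 triangle"
    by (rule recursive1_primrec[of "\<lambda>n t. t + Suc n" _ 0])
      (auto intro!: recursive2_comp2[OF recursive2_add] recursive2_Suc recursive2_fst recursive2_snd)
  then show ?thesis
    unfolding prod_encode_def split
    by (intro recursive2_comp2[OF recursive2_add] recursive2_comp1[of triangle]
        recursive2_add recursive2_fst)
qed


section \<open>A Horn program for recursive functions\<close>

instance recf :: countable
  by countable_datatype

text \<open>
  The relations of the logic program.  Minimization is the only scheme with an unbounded number
  of premises; the auxiliary relation \<open>Loop f\<close> collects them one at a time.
\<close>
datatype pred = Input | Ev recf | Loop recf | Halt

instance pred :: countable
  by countable_datatype

text \<open>
  The intended meaning of the relations, where \<open>k\<close> is the number given to the program as its
  input.  \<open>Halt\<close> is interpreted as false, since the interpretation serves to show what is not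
  derivable when the computation diverges.
\<close>
fun holds :: "nat \<Rightarrow> pred \<Rightarrow> nat list \<Rightarrow> nat \<Rightarrow> bool" where
  "holds k Input xs n \<longleftrightarrow> n = k"
| "holds k (Ev f) xs y \<longleftrightarrow> evaluates f xs y"
| "holds k (Loop f) xs n \<longleftrightarrow> (\<forall>m<n. \<exists>y. evaluates f (m # xs) (Suc y))"
| "holds k Halt xs y \<longleftrightarrow> False"

fun subterms :: "recf \<Rightarrow> recf list" where
  "subterms (Comp f gs) = Comp f gs # subterms f @ concat (map subterms gs)"
| "subterms (PrimRec f g) = PrimRec f g # subterms f @ subterms g"
| "subterms (Mu f) = Mu f # subterms f"
| "subterms f = [f]"

lemma subst_foldr:
  assumes "\<And>a b. subst \<sigma> (F a b) = F (subst \<sigma> a) (subst \<sigma> b)"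
  shows "subst \<sigma> (foldr F ts u) = foldr F (map (subst \<sigma>) ts) (subst \<sigma> u)"
  by (induction ts) (simp_all add: assms)

locale impl_signature =
  fixes \<Sigma> :: "'c signature"
  assumes signature_with_impl: "signature_with_impl \<Sigma>"
begin

abbreviation imp :: "'c formula \<Rightarrow> 'c formula \<Rightarrow> 'c formula"  (infixr "\<^bold>\<rightarrow>" 60) where
  "A \<^bold>\<rightarrow> B \<equiv> Imp \<Sigma> A B"

text \<open>
  A pairing that is injective on all formulas and never has the form \<open>A \<rightarrow> A\<close>.  Different
  shapes of data therefore remain different under every substitution.
\<close>
definition pair :: "'c formula \<Rightarrow> 'c formula \<Rightarrow> 'c formula" where
  "pair a b = (a \<^bold>\<rightarrow> b) \<^bold>\<rightarrow> b"

text \<open>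
  There are no constants in the language, so zero (and the empty list) has to contain a variable.
  Its instances are the formulas \<open>A \<rightarrow> A\<close>, all of which are read as zero.
\<close>
definition zero :: "'c formula" where
  "zero = Var 0 \<^bold>\<rightarrow> Var 0"

primrec num :: "nat \<Rightarrow> 'c formula" where
  "num 0 = zero"
| "num (Suc n) = pair (num n) (num n)"

definition atom :: "pred \<Rightarrow> 'c formula \<Rightarrow> 'c formula \<Rightarrow> 'c formula" where
  "atom p a r = pair (num (to_nat p)) (pair a r)"

text \<open>
  The formula that asserts an atom is derivable in the base logic whatever the atom is, and as a
  major premise of modus ponens it gives back just its minor premise.
\<close>
definition claim :: "'c formula \<Rightarrow> 'c formula" where
  "claim t = t \<^bold>\<rightarrow> t"

definition clause :: "'c formula list \<Rightarrow> 'c formula \<Rightarrow> 'c formula" where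
  "clause ts X = foldr (\<lambda>t Y. claim t \<^bold>\<rightarrow> Y) ts X"

text \<open>
  Variable 0 is left to the constant \<open>zero\<close> and is kept fixed in derivations.  Usually variable 1 holds
  the argument list (or its unspecified rest) and 2 holds the result.  In the second rule of
  minimization the result \<open>pair (Var 4) (Var 4)\<close> matches, among the numerals, precisely the nonzero ones.
\<close>
fun rules :: "recf \<Rightarrow> ('c formula list \<times> 'c formula) list" where
  "rules Zero = [([], atom (Ev Zero) (Var 1) zero)]"
| "rules Succ = [([], atom (Ev Succ) (pair (Var 1) zero) (pair (Var 1) (Var 1)))]"
| "rules (Proj i) =
     [([], atom (Ev (Proj i)) (foldr pair (map Var [2..<i + 3]) (Var 1)) (Var (i + 2)))]"
| "rules (Comp f gs) =
     [(map (\<lambda>i. atom (Ev (gs ! i)) (Var 1) (Var (i + 3))) [0..<length gs]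
         @ [atom (Ev f) (foldr pair (map (\<lambda>i. Var (i + 3)) [0..<length gs]) zero) (Var 2)],
       atom (Ev (Comp f gs)) (Var 1) (Var 2))]"
| "rules (PrimRec f g) =
     [([atom (Ev f) (Var 1) (Var 2)], atom (Ev (PrimRec f g)) (pair zero (Var 1)) (Var 2)),
      ([atom (Ev (PrimRec f g)) (pair (Var 3) (Var 1)) (Var 4),
        atom (Ev g) (pair (Var 3) (pair (Var 4) (Var 1))) (Var 2)],
       atom (Ev (PrimRec f g)) (pair (pair (Var 3) (Var 3)) (Var 1)) (Var 2))]"
| "rules (Mu f) =
     [([], atom (Loop f) (Var 1) zero),
      ([atom (Loop f) (Var 1) (Var 3), atom (Ev f) (pair (Var 3) (Var 1)) (pair (Var 4) (Var 4))],
       atom (Loop f) (Var 1) (pair (Var 3) (Var 3))),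
      ([atom (Loop f) (Var 1) (Var 3), atom (Ev f) (pair (Var 3) (Var 1)) zero],
       atom (Ev (Mu f)) (Var 1) (Var 3))]"

definition program :: "recf \<Rightarrow> 'c formula list" where
  "program f = map (\<lambda>(ts, t). clause ts (claim t)) (concat (map rules (subterms f)))"

definition halt :: "'c formula" where
  "halt = atom Halt zero zero"

text \<open>
  The input is an axiom of its own and not a part of \<open>halting_clause\<close>, so that its code depends
  on the number only and not on the function to be run.  The diagonal argument needs this: the
  function that it runs computes this very code.
\<close>
definition input :: "nat \<Rightarrow> 'c formula" where
  "input n = claim (atom Input zero (num n))"

definition halting_clause :: "recf \<Rightarrow> 'c formula" where
  "halting_clause f =
     clause [atom Input zero (Var 1), atom (Ev f) (pair (Var 1) zero) (Var 2)] (claim halt)"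

lemma subst_pair [simp]: "subst \<sigma> (pair a b) = pair (subst \<sigma> a) (subst \<sigma> b)"
  by (simp add: pair_def)

lemma subst_claim [simp]: "subst \<sigma> (claim t) = claim (subst \<sigma> t)"
  by (simp add: claim_def)

lemma subst_clause: "subst \<sigma> (clause ts X) = clause (map (subst \<sigma>) ts) (subst \<sigma> X)"
  by (induction ts) (simp_all add: clause_def)

lemma pair_inject [simp]: "pair a b = pair a' b' \<longleftrightarrow> a = a' \<and> b = b'"
  by (auto simp: pair_def)

text \<open>If both sides agreed, \<open>b\<close> would be a proper subformula of itself.\<close>
lemma pair_neq_self_imp [simp]: "pair a b \<noteq> A \<^bold>\<rightarrow> A"
proof
  assume "pair a b = A \<^bold>\<rightarrow> A"
  then have "b = a \<^bold>\<rightarrow> b" unfolding pair_def by (metis formula.inject(2) list.inject)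
  then have "size b = size (a \<^bold>\<rightarrow> b)" by (rule arg_cong)
  then show False by simp
qed

lemma imp_in_formulas [simp]: "A \<in> formulas \<Sigma> \<Longrightarrow> B \<in> formulas \<Sigma> \<Longrightarrow> A \<^bold>\<rightarrow> B \<in> formulas \<Sigma>"
  using signature_with_impl unfolding signature_with_impl_def
  by (intro formulas.App) auto

lemma Var_in_formulas [simp]: "Var v \<in> formulas \<Sigma>"
  by (rule formulas.Var)

lemma pair_in_formulas [simp]: "a \<in> formulas \<Sigma> \<Longrightarrow> b \<in> formulas \<Sigma> \<Longrightarrow> pair a b \<in> formulas \<Sigma>"
  by (simp add: pair_def)

lemma zero_in_formulas [simp]: "zero \<in> formulas \<Sigma>"
  by (simp add: zero_def)

lemma num_in_formulas [simp]: "num n \<in> formulas \<Sigma>"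
  by (induction n) simp_all

lemma atom_in_formulas [simp]:
  "a \<in> formulas \<Sigma> \<Longrightarrow> r \<in> formulas \<Sigma> \<Longrightarrow> atom p a r \<in> formulas \<Sigma>"
  by (simp add: atom_def)

lemma claim_in_formulas [simp]: "t \<in> formulas \<Sigma> \<Longrightarrow> claim t \<in> formulas \<Sigma>"
  by (simp add: claim_def)

lemma foldr_pair_in_formulas [simp]:
  "set ts \<subseteq> formulas \<Sigma> \<Longrightarrow> u \<in> formulas \<Sigma> \<Longrightarrow> foldr pair ts u \<in> formulas \<Sigma>"
  by (induction ts) auto

lemma clause_in_formulas:
  "set ts \<subseteq> formulas \<Sigma> \<Longrightarrow> X \<in> formulas \<Sigma> \<Longrightarrow> clause ts X \<in> formulas \<Sigma>"
  by (induction ts) (auto simp: clause_def)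

lemma rules_in_formulas: "(ts, t) \<in> set (rules f) \<Longrightarrow> set ts \<subseteq> formulas \<Sigma> \<and> t \<in> formulas \<Sigma>"
  by (cases f) (auto intro!: atom_in_formulas foldr_pair_in_formulas)

lemma halt_in_formulas [simp]: "halt \<in> formulas \<Sigma>"
  by (simp add: halt_def)


section \<open>Halting computations are derivable\<close>

lemma modus_ponens:
  "A \<in> theorems (\<Sigma>, B) \<Longrightarrow> A \<^bold>\<rightarrow> C \<in> theorems (\<Sigma>, B) \<Longrightarrow> C \<in> theorems (\<Sigma>, B)"
  by (rule theorems.MP) simp_all

lemma clause_elim:
  assumes "clause ts X \<in> theorems (\<Sigma>, B)" "\<forall>t\<in>set ts. claim t \<in> theorems (\<Sigma>, B)"
  shows "X \<in> theorems (\<Sigma>, B)"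
  using assms
proof (induction ts)
  case Nil
  then show ?case by (simp add: clause_def)
next
  case (Cons t ts)
  have "claim t \<^bold>\<rightarrow> clause ts X \<in> theorems (\<Sigma>, B)"
    using Cons.prems(1) by (simp add: clause_def)
  moreover have "claim t \<in> theorems (\<Sigma>, B)"
    using Cons.prems(2) by simp
  ultimately have "clause ts X \<in> theorems (\<Sigma>, B)"
    by (rule modus_ponens[rotated])
  with Cons show ?case by simp
qed

lemma clause_apply:
  assumes "clause ts (claim t) \<in> B" "\<forall>v. \<sigma> v \<in> formulas \<Sigma>"
    and "\<forall>s\<in>set ts. claim (subst \<sigma> s) \<in> theorems (\<Sigma>, B)"
  shows "claim (subst \<sigma> t) \<in> theorems (\<Sigma>, B)"
proof -
  have "subst \<sigma> (clause ts (claim t)) \<in> theorems (\<Sigma>, B)"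
    using theorems.Subst[OF theorems.Axiom[of "clause ts (claim t)" "(\<Sigma>, B)"], of \<sigma>] assms(1,2)
    by simp
  then have "clause (map (subst \<sigma>) ts) (claim (subst \<sigma> t)) \<in> theorems (\<Sigma>, B)"
    by (simp add: subst_clause)
  then show ?thesis
    by (rule clause_elim) (use assms(3) in simp)
qed

lemma subst_zero: "\<sigma> 0 = Var 0 \<Longrightarrow> subst \<sigma> zero = zero"
  by (simp add: zero_def)

lemma subst_num: "\<sigma> 0 = Var 0 \<Longrightarrow> subst \<sigma> (num n) = num n"
  by (induction n) (simp_all add: subst_zero)

lemma subst_atom: "\<sigma> 0 = Var 0 \<Longrightarrow> subst \<sigma> (atom p a r) = atom p (subst \<sigma> a) (subst \<sigma> r)"
  by (simp add: atom_def subst_num)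

definition numlist :: "nat list \<Rightarrow> 'c formula" where
  "numlist xs = foldr pair (map num xs) zero"

lemma numlist_simps [simp]: "numlist [] = zero" "numlist (x # xs) = pair (num x) (numlist xs)"
  by (simp_all add: numlist_def)

lemma numlist_in_formulas [simp]: "numlist xs \<in> formulas \<Sigma>"
  by (induction xs) simp_all

lemma numlist_append: "numlist (xs @ ys) = foldr pair (map num xs) (numlist ys)"
  by (simp add: numlist_def)

text \<open>
  The rules mirror the clauses of the big-step semantics, so each step of an evaluation becomes
  an application of one instance of a rule.
\<close>
lemma evaluates_derivable:
  assumes "evaluates f xs y" "set (program f) \<subseteq> B"
  shows "claim (atom (Ev f) (numlist xs) (num y)) \<in> theorems (\<Sigma>, B)"
  using assms
proof (induction rule: evaluates.induct)
  case (Zero xs)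
  then show ?case
    using clause_apply[of "[]" "atom (Ev Zero) (Var 1) zero" B "Var(1 := numlist xs)"]
    by (simp add: program_def subst_atom subst_zero)
next
  case (Succ x)
  then show ?case
    using clause_apply[of "[]" "atom (Ev Succ) (pair (Var 1) zero) (pair (Var 1) (Var 1))" B
        "Var(1 := num x)"]
    by (simp add: program_def subst_atom subst_zero)
next
  case (Proj i xs)
  \<comment> \<open>The variables \<open>2, \<dots>, i + 2\<close> take the first \<open>i + 1\<close> arguments, variable 1 the rest.\<close>
  define \<sigma> where "\<sigma> v = (if v = 0 then Var 0 else if v = 1 then numlist (drop (Suc i) xs)
      else num (xs ! (v - 2)))" for v
  have "map \<sigma> [2..<i + 3] = map num (take (Suc i) xs)"
    using Proj.hyps by (intro nth_equalityI) (auto simp: \<sigma>_def simp del: upt_Suc)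
  moreover have \<sigma>: "\<sigma> 0 = Var 0" "\<sigma> 1 = numlist (drop (Suc i) xs)" "\<sigma> (i + 2) = num (xs ! i)"
    "\<forall>v. \<sigma> v \<in> formulas \<Sigma>"
    by (simp_all add: \<sigma>_def)
  ultimately have "subst \<sigma> (foldr pair (map Var [2..<i + 3]) (Var 1)) = numlist xs"
    using numlist_append[of "take (Suc i) xs" "drop (Suc i) xs"]
    by (simp add: subst_foldr o_def del: upt_Suc One_nat_def)
  then show ?case
    using clause_apply[of "[]"
        "atom (Ev (Proj i)) (foldr pair (map Var [2..<i + 3]) (Var 1)) (Var (i + 2))" B \<sigma>] Proj.prems
    by (simp add: program_def subst_atom \<sigma> del: upt_Suc One_nat_def add_2_eq_Suc')
next
  case (Comp xs gs ys f z)
  have len: "length gs = length ys"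
    using Comp.IH(1) by (rule list_all2_lengthD)
  have g: "claim (atom (Ev (gs ! i)) (numlist xs) (num (ys ! i))) \<in> theorems (\<Sigma>, B)"
    if "i < length gs" for i
  proof -
    have "set (program (gs ! i)) \<subseteq> set (program (Comp f gs))"
      using that by (force simp: program_def)
    then show ?thesis using Comp.IH(1) Comp.prems that by (auto simp: list_all2_conv_all_nth)
  qed
  have f: "claim (atom (Ev f) (numlist ys) (num z)) \<in> theorems (\<Sigma>, B)"
    using Comp.IH(2) Comp.prems by (auto simp: program_def)
  define \<sigma> where "\<sigma> v = (if v = 0 then Var 0 else if v = 1 then numlist xs
      else if v = 2 then num z else num (ys ! (v - 3)))" for v
  have "map (\<lambda>i. \<sigma> (i + 3)) [0..<length gs] = map num ys"
    using len by (intro nth_equalityI) (auto simp: \<sigma>_def)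
  then have ys: "subst \<sigma> (foldr pair (map (\<lambda>i. Var (i + 3)) [0..<length gs]) zero) = numlist ys"
    by (simp add: subst_foldr o_def numlist_def subst_zero \<sigma>_def)
  have \<sigma>: "\<sigma> 0 = Var 0" "\<sigma> 1 = numlist xs" "\<sigma> 2 = num z" "\<And>i. \<sigma> (i + 3) = num (ys ! i)"
    "\<And>v. \<sigma> v \<in> formulas \<Sigma>"
    by (simp_all add: \<sigma>_def)
  obtain ts t where r: "rules (Comp f gs) = [(ts, t)]"
    and ts: "ts = map (\<lambda>i. atom (Ev (gs ! i)) (Var 1) (Var (i + 3))) [0..<length gs]
         @ [atom (Ev f) (foldr pair (map (\<lambda>i. Var (i + 3)) [0..<length gs]) zero) (Var 2)]"
    and t: "t = atom (Ev (Comp f gs)) (Var 1) (Var 2)"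
    by simp
  have "clause ts (claim t) \<in> B"
    using Comp.prems r unfolding program_def by auto
  moreover have "claim (subst \<sigma> s) \<in> theorems (\<Sigma>, B)" if "s \<in> set ts" for s
    using that g f unfolding ts by (auto simp: subst_atom \<sigma> ys simp del: One_nat_def)
  ultimately have "claim (subst \<sigma> t) \<in> theorems (\<Sigma>, B)"
    using \<sigma>(5) by (intro clause_apply) auto
  then show ?case by (simp add: t subst_atom \<sigma> del: One_nat_def)
next
  case (PrimRec_0 f xs z g)
  have "set (program f) \<subseteq> B" using PrimRec_0.prems by (auto simp: program_def)
  with PrimRec_0.IH have "claim (atom (Ev f) (numlist xs) (num z)) \<in> theorems (\<Sigma>, B)" by blast
  then show ?case
    using clause_apply[of "[atom (Ev f) (Var 1) (Var 2)]"
        "atom (Ev (PrimRec f g)) (pair zero (Var 1)) (Var 2)" B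
        "Var(1 := numlist xs, 2 := num z)"] PrimRec_0.prems
    by (simp add: program_def subst_atom subst_zero)
next
  case (PrimRec_Suc f g n xs y z)
  have "set (program g) \<subseteq> B" using PrimRec_Suc.prems by (auto simp: program_def)
  with PrimRec_Suc.IH PrimRec_Suc.prems show ?case
    using clause_apply[of "[atom (Ev (PrimRec f g)) (pair (Var 3) (Var 1)) (Var 4),
        atom (Ev g) (pair (Var 3) (pair (Var 4) (Var 1))) (Var 2)]"
        "atom (Ev (PrimRec f g)) (pair (pair (Var 3) (Var 3)) (Var 1)) (Var 2)" B
        "Var(1 := numlist xs, 2 := num z, 3 := num n, 4 := num y)"]
    by (simp add: program_def subst_atom)
next
  case (Mu f n xs)
  have sub: "set (program f) \<subseteq> B" using Mu.prems by (auto simp: program_def)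
  \<comment> \<open>The values below \<open>n\<close> are nonzero, so the loop counter can be raised up to \<open>n\<close>.\<close>
  have "m \<le> n \<Longrightarrow> claim (atom (Loop f) (numlist xs) (num m)) \<in> theorems (\<Sigma>, B)" for m
  proof (induction m)
    case 0
    show ?case
      using clause_apply[of "[]" "atom (Loop f) (Var 1) zero" B "Var(1 := numlist xs)"] Mu.prems
      by (simp add: program_def subst_atom subst_zero)
  next
    case (Suc m)
    then have "m < n" by simp
    then obtain y where
      "claim (atom (Ev f) (numlist (m # xs)) (num (Suc y))) \<in> theorems (\<Sigma>, B)"
      using Mu.IH(2) sub by blast
    then show ?case
      using clause_apply[of
          "[atom (Loop f) (Var 1) (Var 3), atom (Ev f) (pair (Var 3) (Var 1)) (pair (Var 4) (Var 4))]"
          "atom (Loop f) (Var 1) (pair (Var 3) (Var 3))" B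
          "Var(1 := numlist xs, 3 := num m, 4 := num y)"] Mu.prems Suc.IH \<open>m < n\<close>
      by (simp add: program_def subst_atom)
  qed
  moreover have "claim (atom (Ev f) (numlist (n # xs)) (num 0)) \<in> theorems (\<Sigma>, B)"
    using Mu.IH(1) sub by blast
  ultimately show ?case
    using clause_apply[of
        "[atom (Loop f) (Var 1) (Var 3), atom (Ev f) (pair (Var 3) (Var 1)) zero]"
        "atom (Ev (Mu f)) (Var 1) (Var 3)" B "Var(1 := numlist xs, 3 := num n)"] Mu.prems
    by (simp add: program_def subst_atom subst_zero)
qed

lemma halt_derivable:
  assumes "evaluates f [n] y" "set (program f) \<subseteq> B" "input n \<in> B" "halting_clause f \<in> B"
  shows "claim halt \<in> theorems (\<Sigma>, B)"
proof -
  let ?\<sigma> = "Var(1 := num n, 2 := num y)"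
  have "claim (atom (Ev f) (pair (num n) zero) (num y)) \<in> theorems (\<Sigma>, B)"
    using evaluates_derivable[OF assms(1,2)] by simp
  moreover have "claim (atom Input zero (num n)) \<in> theorems (\<Sigma>, B)"
    using assms(3) unfolding input_def by (intro theorems.Axiom) simp
  ultimately have "claim (subst ?\<sigma> halt) \<in> theorems (\<Sigma>, B)"
    using assms(4)
    by (intro clause_apply[of "[atom Input zero (Var 1), atom (Ev f) (pair (Var 1) zero) (Var 2)]"])
      (simp_all add: halting_clause_def subst_atom subst_zero)
  then show ?thesis by (simp add: halt_def subst_atom subst_zero)
qed


section \<open>Soundness of the program\<close>

text \<open>
  Clauses may be instantiated with arbitrary formulas, and different occurrences of \<open>zero\<close> may
  become different formulas.  Hence numerals are decoded by relations that accept every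
  \<open>A \<rightarrow> A\<close> as zero.  A formula has at most one value, but may have none.
\<close>
inductive isnum :: "nat \<Rightarrow> 'c formula \<Rightarrow> bool" where
  "isnum 0 (A \<^bold>\<rightarrow> A)"
| "isnum n t \<Longrightarrow> isnum (Suc n) (pair t t)"

inductive islist :: "nat list \<Rightarrow> 'c formula \<Rightarrow> bool" where
  "islist [] (A \<^bold>\<rightarrow> A)"
| "isnum n t \<Longrightarrow> islist ns l \<Longrightarrow> islist (n # ns) (pair t l)"

lemma isnum_self_imp [simp]: "isnum n (A \<^bold>\<rightarrow> A) \<longleftrightarrow> n = 0"
  by (subst isnum.simps) (auto simp: pair_neq_self_imp[symmetric] simp del: pair_neq_self_imp)

lemma isnum_pair [simp]: "isnum n (pair t u) \<longleftrightarrow> t = u \<and> (\<exists>m. n = Suc m \<and> isnum m t)"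
  by (subst isnum.simps) auto

lemma islist_self_imp [simp]: "islist ns (A \<^bold>\<rightarrow> A) \<longleftrightarrow> ns = []"
  by (subst islist.simps) (auto simp: pair_neq_self_imp[symmetric] simp del: pair_neq_self_imp)

lemma islist_pair [simp]:
  "islist ns (pair t l) \<longleftrightarrow> (\<exists>m ms. ns = m # ms \<and> isnum m t \<and> islist ms l)"
  by (subst islist.simps) auto

lemma isnum_unique: "isnum n t \<Longrightarrow> isnum m t \<Longrightarrow> n = m"
proof (induction arbitrary: m rule: isnum.induct)
  case (1 A)
  then show ?case by simp
next
  case (2 n t)
  from 2(3) obtain m' where m': "m = Suc m'" "isnum m' t" by auto
  from 2(2)[OF m'(2)] m'(1) show ?case by simp
qed

lemma isnum_subst_zero [simp]: "isnum n (subst \<sigma> zero) \<longleftrightarrow> n = 0"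
  by (simp add: zero_def)

lemma islist_subst_zero [simp]: "islist ns (subst \<sigma> zero) \<longleftrightarrow> ns = []"
  by (simp add: zero_def)

lemma isnum_subst_num [simp]: "isnum m (subst \<sigma> (num n)) \<longleftrightarrow> m = n"
proof -
  have "isnum n (subst \<sigma> (num n))" by (induction n) auto
  then show ?thesis using isnum_unique by blast
qed

text \<open>
  An atom is true if it is so for the numbers that its arguments denote; an atom whose arguments
  denote no list of numbers makes no statement.  That the result denotes a number is part of what
  is asserted, so that results can be passed on as arguments.
\<close>
definition true_atom :: "nat \<Rightarrow> 'c formula \<Rightarrow> bool" where
  "true_atom k t \<longleftrightarrow> (\<forall>g a r p xs. t = pair g (pair a r) \<longrightarrow> isnum (to_nat p) g \<longrightarrow> islist xs a \<longrightarrow>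
     (\<exists>n. isnum n r \<and> holds k p xs n))"

lemma true_atom_subst [simp]:
  "true_atom k (subst \<sigma> (atom p a r)) \<longleftrightarrow>
    (\<forall>xs. islist xs (subst \<sigma> a) \<longrightarrow> (\<exists>n. isnum n (subst \<sigma> r) \<and> holds k p xs n))"
  by (auto simp: true_atom_def atom_def)

text \<open>
  Truth of a clause in the interpretation, defined by recursion on the formula: a premise
  \<open>claim t\<close> is an assumption that \<open>t\<close> is true.  The condition on \<open>t\<close> in the second case separates
  genuine premises from claims \<open>(A \<rightarrow> A) \<rightarrow> (A \<rightarrow> A)\<close>, and thereby makes \<open>sound\<close> closed under
  modus ponens.
\<close>
inductive sound :: "nat \<Rightarrow> 'c formula \<Rightarrow> bool" for k where
  "true_atom k t \<Longrightarrow> sound k (claim t)"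
| "\<forall>A. t \<noteq> A \<^bold>\<rightarrow> A \<Longrightarrow> (true_atom k t \<longrightarrow> sound k X) \<Longrightarrow> sound k (claim t \<^bold>\<rightarrow> X)"

text \<open>
  If the major premise is a claim, the conclusion is the minor premise.  If it is a clause with
  premise \<open>claim t\<close>, the minor premise is \<open>claim t\<close>; this can be sound only because \<open>t\<close> is true,
  for otherwise \<open>t\<close> itself would have the form \<open>A \<rightarrow> A\<close>.
\<close>
lemma sound_MP:
  assumes "sound k (X \<^bold>\<rightarrow> Y)" "sound k X"
  shows "sound k Y"
  using assms(1)
proof cases
  case (1 t)
  then show ?thesis using assms(2) by (simp add: claim_def)
next
  case (2 t)
  from assms(2) have "true_atom k t"
    by cases (use 2 in \<open>auto simp: claim_def\<close>)
  with 2 show ?thesis by simp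
qed

text \<open>
  Soundness is not preserved by substitution, because an assumption that fails for \<open>t\<close> may hold
  for an instance of \<open>t\<close>.  Soundness of all instances is.
\<close>
lemma theorems_sound:
  assumes "\<And>A \<sigma>. A \<in> B \<Longrightarrow> sound k (subst \<sigma> A)" "A \<in> theorems (\<Sigma>, B)"
  shows "sound k (subst \<sigma> A)"
  using assms(2)
proof (induction arbitrary: \<sigma> rule: theorems.induct)
  case (Axiom A)
  then show ?case using assms(1) by simp
next
  case (MP A B)
  then show ?case by (auto intro: sound_MP)
next
  case (Subst A \<tau>)
  have "subst \<sigma> (subst \<tau> A) = subst (\<lambda>v. subst \<sigma> (\<tau> v)) A"
    by (induction A) auto
  then show ?case using Subst.IH by simp
qed

lemma sound_clause:
  assumes "\<forall>s\<in>set ts. \<forall>A. s \<noteq> A \<^bold>\<rightarrow> A" "(\<forall>s\<in>set ts. true_atom k s) \<longrightarrow> sound k X"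
  shows "sound k (clause ts X)"
  using assms by (induction ts) (auto simp: clause_def intro: sound.intros)

lemma subst_atom_neq_self_imp: "subst \<sigma> (atom p a r) \<noteq> A \<^bold>\<rightarrow> A"
  by (simp add: atom_def)

lemma islist_foldr_pair:
  "islist ns (foldr pair ts l) \<longleftrightarrow>
    (\<exists>ms ks. ns = ms @ ks \<and> list_all2 isnum ms ts \<and> islist ks l)"
proof (induction ts arbitrary: ns)
  case Nil
  then show ?case by simp
next
  case (Cons t ts)
  show ?case
    by (simp add: Cons list_all2_Cons2) (metis append_Cons)
qed

text \<open>
  Once instances of terms are decoded into numbers, this is the reading of the rules as clauses
  of the big-step semantics.
\<close>
lemma rules_sound:
  assumes "(ts, t) \<in> set (rules f)"
  shows "(\<forall>s\<in>set ts. true_atom k (subst \<sigma> s)) \<longrightarrow> true_atom k (subst \<sigma> t)"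
proof (cases f)
  case Zero
  then show ?thesis using assms by (auto intro: evaluates.Zero)
next
  case Succ
  then show ?thesis using assms by (auto intro: evaluates.Succ)
next
  case (Proj i)
  have "evaluates (Proj i) (ms @ ks) (ms ! i) \<and> isnum (ms ! i) (\<sigma> (i + 2))"
    if "list_all2 isnum ms (map \<sigma> [2..<i + 3])" for ms ks
  proof -
    have "length ms = Suc i" "isnum (ms ! i) (\<sigma> (i + 2))"
      using that by (auto simp: list_all2_conv_all_nth add.commute simp del: upt_Suc)
    then show ?thesis using evaluates.Proj[of i "ms @ ks"] by (simp add: nth_append)
  qed
  then show ?thesis
    using assms Proj
    by (auto simp: subst_foldr islist_foldr_pair o_def simp del: upt_Suc)
next
  case (Comp h gs)
  have "\<exists>n. isnum n (\<sigma> 2) \<and> evaluates (Comp h gs) xs n"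
    if g: "\<And>i. i < length gs \<Longrightarrow> \<exists>n. isnum n (\<sigma> (i + 3)) \<and> evaluates (gs ! i) xs n"
      and h: "\<And>ys. list_all2 isnum ys (map (\<lambda>i. \<sigma> (i + 3)) [0..<length gs])
        \<Longrightarrow> \<exists>n. isnum n (\<sigma> 2) \<and> evaluates h ys n" for xs
  proof -
    obtain y where y: "\<And>i. i < length gs \<Longrightarrow> isnum (y i) (\<sigma> (i + 3)) \<and> evaluates (gs ! i) xs (y i)"
      using g by metis
    obtain n where "isnum n (\<sigma> 2)" "evaluates h (map y [0..<length gs]) n"
      using h[of "map y [0..<length gs]"] y by (auto simp: list_all2_conv_all_nth)
    moreover have "list_all2 (\<lambda>g y. evaluates g xs y) gs (map y [0..<length gs])"
      using y by (auto simp: list_all2_conv_all_nth)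
    ultimately show ?thesis by (blast intro: evaluates.Comp)
  qed
  then show ?thesis
    using assms Comp by (auto simp: subst_foldr islist_foldr_pair o_def)
next
  case (PrimRec h g)
  then show ?thesis
    using assms by (auto simp del: One_nat_def) (blast intro: evaluates.PrimRec_0 evaluates.PrimRec_Suc)+
next
  case (Mu h)
  show ?thesis
  proof
    assume *: "\<forall>s\<in>set ts. true_atom k (subst \<sigma> s)"
    consider "ts = []" "t = atom (Loop h) (Var 1) zero"
      | "ts = [atom (Loop h) (Var 1) (Var 3), atom (Ev h) (pair (Var 3) (Var 1)) (pair (Var 4) (Var 4))]"
        "t = atom (Loop h) (Var 1) (pair (Var 3) (Var 3))"
      | "ts = [atom (Loop h) (Var 1) (Var 3), atom (Ev h) (pair (Var 3) (Var 1)) zero]"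
        "t = atom (Ev (Mu h)) (Var 1) (Var 3)"
      using assms Mu by auto
    then show "true_atom k (subst \<sigma> t)"
    proof cases
      case 1
      then show ?thesis by simp
    next
      case 2
      then show ?thesis using * by (simp del: One_nat_def) (metis less_SucE)
    next
      case 3
      then show ?thesis using * by (simp del: One_nat_def) (metis evaluates.Mu)
    qed
  qed
qed

lemma program_sound:
  assumes "A \<in> set (program f)"
  shows "sound k (subst \<sigma> A)"
proof -
  obtain g ts t where r: "(ts, t) \<in> set (rules g)" and A: "A = clause ts (claim t)"
    using assms by (auto simp: program_def)
  have "\<forall>s\<in>set (map (subst \<sigma>) ts). \<forall>A. s \<noteq> A \<^bold>\<rightarrow> A"
    using r by (cases g) (auto simp: subst_atom_neq_self_imp)
  then show ?thesis
    unfolding A subst_clause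
    by (rule sound_clause) (use rules_sound[OF r] in \<open>auto intro: sound.intros\<close>)
qed

text \<open>
  In the interpretation with input \<open>n\<close> the first premise forces variable 1 to denote \<open>n\<close>; then
  the second one fails for a diverging computation.
\<close>
lemma halting_clause_sound:
  assumes "\<nexists>y. evaluates f [n] y"
  shows "sound n (subst \<sigma> (halting_clause f))"
  unfolding halting_clause_def subst_clause
  by (rule sound_clause) (use assms in \<open>auto simp: subst_atom_neq_self_imp simp del: One_nat_def\<close>)


lemma input_sound: "sound n (subst \<sigma> (input n))"
  by (auto simp: input_def intro: sound.intros)

lemma halt_clause_sound: "sound k (subst \<sigma> (clause [halt] A))"
  unfolding halt_def subst_clause
  by (rule sound_clause) (auto simp: subst_atom_neq_self_imp)

text \<open>
  Its premise is a variable, which is not a claim, and differs from its conclusion.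
\<close>
lemma K_not_sound: "\<not> sound k (Var 0 \<^bold>\<rightarrow> (Var 1 \<^bold>\<rightarrow> Var 0))"
  by (subst sound.simps) (simp add: claim_def)


section \<open>The axiom system of a computation\<close>

lemma K_derivable:
  assumes "Int_impl \<Sigma> \<preceq> (\<Sigma>, P)" "A \<in> formulas \<Sigma>" "B \<in> formulas \<Sigma>"
  shows "A \<^bold>\<rightarrow> (B \<^bold>\<rightarrow> A) \<in> theorems (\<Sigma>, P)"
proof -
  have "Var 0 \<^bold>\<rightarrow> (Var 1 \<^bold>\<rightarrow> Var 0) \<in> theorems (Int_impl \<Sigma>)"
    by (rule theorems.Axiom) (simp add: Int_impl_def Let_def)
  then have "Var 0 \<^bold>\<rightarrow> (Var 1 \<^bold>\<rightarrow> Var 0) \<in> theorems (\<Sigma>, P)"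
    using assms(1) by (auto simp: calc_le_def)
  from theorems.Subst[OF this, of "Var(0 := A, 1 := B)"] assms(2,3) show ?thesis by simp
qed

lemma S_derivable:
  assumes "Int_impl \<Sigma> \<preceq> (\<Sigma>, P)" "A \<in> formulas \<Sigma>" "B \<in> formulas \<Sigma>" "C \<in> formulas \<Sigma>"
  shows "(A \<^bold>\<rightarrow> (B \<^bold>\<rightarrow> C)) \<^bold>\<rightarrow> ((A \<^bold>\<rightarrow> B) \<^bold>\<rightarrow> (A \<^bold>\<rightarrow> C)) \<in> theorems (\<Sigma>, P)"
proof -
  let ?S = "(Var 0 \<^bold>\<rightarrow> (Var 1 \<^bold>\<rightarrow> Var 2)) \<^bold>\<rightarrow> ((Var 0 \<^bold>\<rightarrow> Var 1) \<^bold>\<rightarrow> (Var 0 \<^bold>\<rightarrow> Var 2))"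
  have "?S \<in> theorems (Int_impl \<Sigma>)"
    by (rule theorems.Axiom) (simp add: Int_impl_def Let_def)
  then have "?S \<in> theorems (\<Sigma>, P)"
    using assms(1) by (auto simp: calc_le_def)
  from theorems.Subst[OF this, of "Var(0 := A, 1 := B, 2 := C)"] assms(2-4) show ?thesis by simp
qed

lemma claim_derivable:
  assumes "Int_impl \<Sigma> \<preceq> (\<Sigma>, P)" "t \<in> formulas \<Sigma>"
  shows "claim t \<in> theorems (\<Sigma>, P)"
proof -
  have "(t \<^bold>\<rightarrow> (t \<^bold>\<rightarrow> t)) \<^bold>\<rightarrow> (t \<^bold>\<rightarrow> t) \<in> theorems (\<Sigma>, P)"
    using assms by (intro modus_ponens[OF K_derivable S_derivable]) simp_all
  then show ?thesis
    unfolding claim_def by (rule modus_ponens[OF K_derivable[OF assms(1,2,2)]])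
qed

lemma clause_derivable:
  assumes "Int_impl \<Sigma> \<preceq> (\<Sigma>, P)" "set ts \<subseteq> formulas \<Sigma>" "X \<in> formulas \<Sigma>" "X \<in> theorems (\<Sigma>, P)"
  shows "clause ts X \<in> theorems (\<Sigma>, P)"
  using assms(2)
proof (induction ts)
  case Nil
  then show ?case by (simp add: clause_def assms(4))
next
  case (Cons t ts)
  then have "claim t \<^bold>\<rightarrow> clause ts X \<in> theorems (\<Sigma>, P)"
    using assms(1,3) by (intro modus_ponens[OF _ K_derivable]) (auto intro: clause_in_formulas)
  then show ?case by (simp add: clause_def)
qed

lemma theorems_mono_axioms:
  assumes "A \<in> theorems (\<Sigma>, P)" "P \<subseteq> theorems (\<Sigma>, B)"
  shows "A \<in> theorems (\<Sigma>, B)"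
  using assms(1)
proof (induction rule: theorems.induct)
  case (Axiom A)
  then show ?case using assms(2) by auto
next
  case (MP A C)
  from MP.IH show ?case unfolding fst_conv by (rule modus_ponens)
next
  case (Subst A \<sigma>)
  then show ?case by (auto intro: theorems.Subst)
qed

text \<open>
  The detour from \<open>halting_clause\<close> over the closed goal \<open>halt\<close> keeps the variables of the
  formulas in \<open>As\<close> apart from those of the program, so that these formulas are derived
  themselves and not only some of their instances.
\<close>
definition computation :: "'c formula list \<Rightarrow> recf \<Rightarrow> 'c formula list" where
  "computation As f = program f @ halting_clause f # map (\<lambda>A. clause [halt] A) As"

lemma computation_in_formulas:
  assumes "set As \<subseteq> formulas \<Sigma>"
  shows "set (input n # computation As f) \<subseteq> formulas \<Sigma>"
  using assms rules_in_formulas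
  by (fastforce simp: computation_def input_def halting_clause_def program_def intro!: clause_in_formulas)

lemma computation_le:
  assumes "Int_impl \<Sigma> \<preceq> (\<Sigma>, set As)" "set As \<subseteq> formulas \<Sigma>"
  shows "(\<Sigma>, set (input n # computation As f)) \<preceq> (\<Sigma>, set As)"
proof -
  let ?T = "theorems (\<Sigma>, set As)"
  have claim: "clause ts (claim t) \<in> ?T" if "set ts \<subseteq> formulas \<Sigma>" "t \<in> formulas \<Sigma>" for ts t
    using that by (intro clause_derivable claim_derivable assms(1)) simp_all
  have "set (program f) \<subseteq> ?T"
    unfolding program_def by (auto dest!: rules_in_formulas intro!: claim)
  moreover have "halting_clause f \<in> ?T"
    unfolding halting_clause_def by (rule claim) simp_all
  moreover have "input n \<in> ?T"
    unfolding input_def by (rule claim_derivable[OF assms(1)]) simp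
  moreover have "clause [halt] A \<in> ?T" if "A \<in> set As" for A
    using that assms(2) by (intro clause_derivable assms(1) theorems.Axiom) auto
  ultimately have "set (input n # computation As f) \<subseteq> ?T"
    by (auto simp: computation_def)
  then show ?thesis
    unfolding calc_le_def using theorems_mono_axioms by blast
qed

text \<open>
  The reduction of halting to completeness.  If the computation diverges, the calculus fails to
  derive even the weakening axiom.
\<close>
theorem computation_complete_iff:
  assumes "Int_impl \<Sigma> \<preceq> (\<Sigma>, set As)"
  shows "(\<Sigma>, set As) \<preceq> (\<Sigma>, set (input n # computation As f))
    \<longleftrightarrow> (\<exists>y. evaluates f [n] y)"
proof
  let ?B = "set (input n # computation As f)"
  assume le: "(\<Sigma>, set As) \<preceq> (\<Sigma>, ?B)"
  show "\<exists>y. evaluates f [n] y"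
  proof (rule ccontr)
    assume no: "\<nexists>y. evaluates f [n] y"
    have "sound n (subst \<sigma> A)" if "A \<in> ?B" for A \<sigma>
      using that program_sound input_sound halting_clause_sound[OF no] halt_clause_sound
      by (auto simp: computation_def)
    moreover have "Var 0 \<^bold>\<rightarrow> (Var 1 \<^bold>\<rightarrow> Var 0) \<in> theorems (\<Sigma>, ?B)"
      using K_derivable[OF assms, of "Var 0" "Var 1"] le by (auto simp: calc_le_def)
    ultimately have "sound n (subst Var (Var 0 \<^bold>\<rightarrow> (Var 1 \<^bold>\<rightarrow> Var 0)))"
      by (rule theorems_sound)
    then show False using K_not_sound by simp
  qed
next
  let ?B = "set (input n # computation As f)"
  assume "\<exists>y. evaluates f [n] y"
  then have "claim halt \<in> theorems (\<Sigma>, ?B)"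
    using halt_derivable[of f n _ ?B] by (auto simp: computation_def)
  moreover have "clause [halt] A \<in> theorems (\<Sigma>, ?B)" if "A \<in> set As" for A
    using that by (intro theorems.Axiom) (auto simp: computation_def)
  ultimately have "set As \<subseteq> theorems (\<Sigma>, ?B)"
    by (auto intro: clause_elim[of "[halt]"])
  then show "(\<Sigma>, set As) \<preceq> (\<Sigma>, ?B)"
    using theorems_mono_axioms unfolding calc_le_def by blast
qed


section \<open>Diagonalization\<close>

lemma recursive1_code_imp:
  assumes "recursive1 (\<lambda>n. formula_code \<Sigma> (F n))" "recursive1 (\<lambda>n. formula_code \<Sigma> (G n))"
  shows "recursive1 (\<lambda>n. formula_code \<Sigma> (F n \<^bold>\<rightarrow> G n))"
  using assms
  by (auto intro!: recursive1_comp2[OF recursive2_prod_encode] recursive1_Suc recursive1_const)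

text \<open>
  The numerals grow exponentially as formulas, but their codes obey a primitive recursion.
\<close>
lemma recursive1_code_num: "recursive1 (\<lambda>n. formula_code \<Sigma> (num n))"
proof -
  define h where "h a b = prod_encode (Suc (to_nat_on (conns \<Sigma>) (impl \<Sigma>)),
    Suc (prod_encode (a, Suc (prod_encode (b, 0)))))" for a b
  have "recursive2 h"
    unfolding h_def
    by (intro recursive2_comp2[OF recursive2_prod_encode] recursive2_Suc recursive2_const
        recursive2_fst recursive2_snd)
  then have "recursive2 (\<lambda>n c. h (h c c) c)"
    by (intro recursive2_comp2[OF \<open>recursive2 h\<close>] recursive2_snd)
  then show ?thesis
    by (rule recursive1_primrec) (auto simp: pair_def h_def)
qed

lemma recursive1_code_input: "recursive1 (\<lambda>n. formula_code \<Sigma> (input n))"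
  unfolding input_def claim_def atom_def pair_def
  by (intro recursive1_code_imp recursive1_code_num recursive1_const)

text \<open>
  The function \<open>Mu h\<close> below halts on the code of its own program precisely if the assumed decision
  procedure answers that the program does not halt on it.
\<close>
lemma completeness_undecidable:
  assumes "set As \<subseteq> formulas \<Sigma>" and Int: "Int_impl \<Sigma> \<preceq> (\<Sigma>, set As)"
  shows "\<not> decidable_for_calculi \<Sigma> (\<lambda>P. P \<preceq> (\<Sigma>, set As)) (\<lambda>P. (\<Sigma>, set As) \<preceq> P)"
proof
  let ?code = "\<lambda>Bs. list_encode (map (formula_code \<Sigma>) Bs)"
  assume "decidable_for_calculi \<Sigma> (\<lambda>P. P \<preceq> (\<Sigma>, set As)) (\<lambda>P. (\<Sigma>, set As) \<preceq> P)"
  then obtain f where f: "\<And>Bs. set Bs \<subseteq> formulas \<Sigma> \<Longrightarrow> (\<Sigma>, set Bs) \<preceq> (\<Sigma>, set As) \<Longrightarrow>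
      evaluates f [?code Bs] (if (\<Sigma>, set As) \<preceq> (\<Sigma>, set Bs) then 1 else 0)"
    unfolding decidable_for_calculi_def by blast
  \<comment> \<open>On the code \<open>e\<close> of a list of formulas, \<open>G e\<close> is the code of that list with \<open>input e\<close>
      put in front.\<close>
  define G where "G = (\<lambda>e. Suc (prod_encode (formula_code \<Sigma> (input e), e)))"
  have "recursive1 G"
    unfolding G_def
    by (intro recursive1_Suc recursive1_comp2[OF recursive2_prod_encode]
        recursive1_code_input recursive1_id)
  then obtain g where g: "\<And>e. evaluates g [e] (G e)"
    unfolding recursive1_def by blast
  \<comment> \<open>The variable of minimization is ignored, so that \<open>Mu h\<close> halts, with value 0, iff the
      answer of \<open>f\<close> is 0.\<close>
  define h where "h = Comp f [Comp g [Proj 1]]"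
  have h: "evaluates h [n, e] z" if "evaluates f [G e] z" for n e z
  proof -
    have "evaluates (Proj 1) [n, e] e"
      using evaluates.Proj[of 1 "[n, e]"] by simp
    then show ?thesis
      unfolding h_def using g that by (intro evaluates_Comp1)
  qed
  define e where "e = ?code (computation As (Mu h))"
  let ?Bs = "input e # computation As (Mu h)"
  have "evaluates f [?code ?Bs] (if (\<Sigma>, set As) \<preceq> (\<Sigma>, set ?Bs) then 1 else 0)"
    by (rule f[OF computation_in_formulas[OF assms(1)] computation_le[OF Int assms(1)]])
  moreover have "?code ?Bs = G e"
    by (simp add: G_def e_def)
  ultimately have "evaluates f [G e] (if \<exists>y. evaluates (Mu h) [e] y then 1 else 0)"
    unfolding computation_complete_iff[OF Int] by (rule subst[rotated])
  then have run: "evaluates h [n, e] (if \<exists>y. evaluates (Mu h) [e] y then 1 else 0)" for n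
    by (rule h)
  show False
  proof (cases "\<exists>y. evaluates (Mu h) [e] y")
    case True
    then obtain y where "evaluates (Mu h) [e] y" by blast
    then have "evaluates h [y, e] 0" by (cases rule: evaluates.cases) simp_all
    moreover have "evaluates h [y, e] 1" using run[of y] True by simp
    ultimately show False using evaluates_deterministic by fastforce
  next
    case False
    then have "evaluates (Mu h) [e] 0" using run[of 0] by (intro evaluates.Mu) simp_all
    with False show False by blast
  qed
qed

end

theorem theorem2p7:
  fixes \<Sigma> :: "'c signature" and P\<^sub>0 :: "'c formula set"
  assumes "signature_with_impl \<Sigma>"
    and "calculus (\<Sigma>, P\<^sub>0)"
    and "Int_impl \<Sigma> \<preceq> (\<Sigma>, P\<^sub>0)"
  shows "\<not> decidable_for_calculi \<Sigma> (\<lambda>P. True) (\<lambda>P. (\<Sigma>, P\<^sub>0) \<approx> P) \<and>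
         \<not> decidable_for_calculi \<Sigma> (\<lambda>P. P \<preceq> (\<Sigma>, P\<^sub>0)) (\<lambda>P. (\<Sigma>, P\<^sub>0) \<preceq> P)"
proof -
  interpret impl_signature \<Sigma>
    by unfold_locales (rule assms(1))
  have "finite P\<^sub>0" "P\<^sub>0 \<subseteq> formulas \<Sigma>"
    using assms(2) by (simp_all add: calculus_def)
  then obtain As where "P\<^sub>0 = set As"
    by (metis finite_list)
  with \<open>P\<^sub>0 \<subseteq> formulas \<Sigma>\<close> assms(3)
  have complete: "\<not> decidable_for_calculi \<Sigma> (\<lambda>P. P \<preceq> (\<Sigma>, P\<^sub>0)) (\<lambda>P. (\<Sigma>, P\<^sub>0) \<preceq> P)"
    by (simp add: completeness_undecidable)
  have iff: "(\<Sigma>, P\<^sub>0) \<approx> P \<longleftrightarrow> (\<Sigma>, P\<^sub>0) \<preceq> P" if "P \<preceq> (\<Sigma>, P\<^sub>0)" for P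
    using that by (auto simp: calc_equiv_def calc_le_def)
  have "\<not> decidable_for_calculi \<Sigma> (\<lambda>P. True) (\<lambda>P. (\<Sigma>, P\<^sub>0) \<approx> P)"
  proof
    assume "decidable_for_calculi \<Sigma> (\<lambda>P. True) (\<lambda>P. (\<Sigma>, P\<^sub>0) \<approx> P)"
    then obtain f where f: "\<And>As. set As \<subseteq> formulas \<Sigma> \<Longrightarrow>
        evaluates f [list_encode (map (formula_code \<Sigma>) As)] (if (\<Sigma>, P\<^sub>0) \<approx> (\<Sigma>, set As) then 1 else 0)"
      unfolding decidable_for_calculi_def by blast
    have "decidable_for_calculi \<Sigma> (\<lambda>P. P \<preceq> (\<Sigma>, P\<^sub>0)) (\<lambda>P. (\<Sigma>, P\<^sub>0) \<preceq> P)"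
      unfolding decidable_for_calculi_def
    proof (intro exI allI impI)
      fix As
      assume "set As \<subseteq> formulas \<Sigma>" and le: "(\<Sigma>, set As) \<preceq> (\<Sigma>, P\<^sub>0)"
      from f[OF this(1)] show "evaluates f [list_encode (map (formula_code \<Sigma>) As)]
          (if (\<Sigma>, P\<^sub>0) \<preceq> (\<Sigma>, set As) then 1 else 0)"
        unfolding iff[OF le] .
    qed
    with complete show False by blast
  qed
  with complete show ?thesis by blast
qed

end
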